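(* The Greedy Algorithm achieves approximation ratio $$1+\frac{\tau^*}{\mathsf{opt}}\ln\frac{\nu_0-\nu^*}{\tau^*}=1+\frac{\tau^*}{\mathsf{opt}}\cdot\ln\left(1+\frac{\nu_0-\mathsf{opt}}{\tau^*}\right).$$
   Context: Generalized Min-Covering: given non-negative set functions $\nu,\tau$ on subsets of a ground set $U$, with $\nu$ decreasing, $\tau$ sub-additive and $\tau(\emptyset)=0$, find $A\subseteq U$ minimizing $\nu(A)+\tau(A)$. Fix an optimal solution $A^*$, let $\nu^*=\nu(A^* )$, $\tau^*=\tau(A^* )$, $\mathsf{opt}=\tau^*+\nu^*$, and $\nu_0=\nu(\emptyset)$. The Greedy Algorithm starts with $A=\emptyset$ and, while $\nu(A)>\nu^*$, repeatedly adds to $A$ a non-empty set $B$ satisfying the density condition $\frac{\tau(B)}{\nu(A)-\nu(A\cup B)}\le\min\left\{1,\frac{\tau^*}{\nu(A)-\nu^*}\right\}$, as long as such $B$ exists. *)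

theory Defs
  imports Complex_Main
begin

definition set_subadditive_on :: "'a set \<Rightarrow> ('a set \<Rightarrow> real) \<Rightarrow> bool" where
  "set_subadditive_on U \<tau> \<longleftrightarrow>
     (\<forall>A B. A \<subseteq> U \<longrightarrow> B \<subseteq> U \<longrightarrow> \<tau> (A \<union> B) \<le> \<tau> A + \<tau> B)"

definition optimal_solution ::
  "'a set \<Rightarrow> ('a set \<Rightarrow> real) \<Rightarrow> ('a set \<Rightarrow> real) \<Rightarrow> 'a set \<Rightarrow> bool" where
  "optimal_solution U \<nu> \<tau> A \<longleftrightarrow>
     A \<subseteq> U \<and> (\<forall>A'. A' \<subseteq> U \<longrightarrow> \<nu> A + \<tau> A \<le> \<nu> A' + \<tau> A')"

text \<open>
  A density with denominator \<open>0\<close> is undefined and does not meet the density condition. The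
  explicit strict inequality is needed because \<open>x / 0 = 0\<close> for reals in HOL.
\<close>

definition density_condition ::
  "('a set \<Rightarrow> real) \<Rightarrow> ('a set \<Rightarrow> real) \<Rightarrow> real \<Rightarrow> real \<Rightarrow> 'a set \<Rightarrow> 'a set \<Rightarrow> bool" where
  "density_condition \<nu> \<tau> \<nu>s \<tau>s A B \<longleftrightarrow>
     \<nu> (A \<union> B) < \<nu> A \<and>
     \<tau> B / (\<nu> A - \<nu> (A \<union> B)) \<le> min 1 (\<tau>s / (\<nu> A - \<nu>s))"

definition greedy_step ::
  "'a set \<Rightarrow> ('a set \<Rightarrow> real) \<Rightarrow> ('a set \<Rightarrow> real) \<Rightarrow> real \<Rightarrow> real \<Rightarrow> 'a set \<Rightarrow> 'a set \<Rightarrow> bool" where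
  "greedy_step U \<nu> \<tau> \<nu>s \<tau>s A A' \<longleftrightarrow>
     \<nu> A > \<nu>s \<and>
     (\<exists>B. B \<subseteq> U \<and> B \<noteq> {} \<and> density_condition \<nu> \<tau> \<nu>s \<tau>s A B \<and> A' = A \<union> B)"

text \<open>
  The choice of \<open>B\<close> is nondeterministic, so an instance may have several outputs.
\<close>

definition greedy_output ::
  "'a set \<Rightarrow> ('a set \<Rightarrow> real) \<Rightarrow> ('a set \<Rightarrow> real) \<Rightarrow> real \<Rightarrow> real \<Rightarrow> 'a set \<Rightarrow> bool" where
  "greedy_output U \<nu> \<tau> \<nu>s \<tau>s A \<longleftrightarrow>
     (greedy_step U \<nu> \<tau> \<nu>s \<tau>s)\<^sup>*\<^sup>* {} A \<and> (\<nexists>A'. greedy_step U \<nu> \<tau> \<nu>s \<tau>s A A')"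

definition greedy_infinite_run ::
  "'a set \<Rightarrow> ('a set \<Rightarrow> real) \<Rightarrow> ('a set \<Rightarrow> real) \<Rightarrow> real \<Rightarrow> real \<Rightarrow> (nat \<Rightarrow> 'a set) \<Rightarrow> bool" where
  "greedy_infinite_run U \<nu> \<tau> \<nu>s \<tau>s f \<longleftrightarrow>
     f 0 = {} \<and> (\<forall>i. greedy_step U \<nu> \<tau> \<nu>s \<tau>s (f i) (f (Suc i)))"

end

theory Submission
  imports Defs
begin

text \<open>
  Let \<open>x = \<nu>(A) - \<nu>\<^sup>*\<close> and let \<open>\<Phi>\<close> be the antiderivative of \<open>min {1, \<tau>\<^sup>*/x}\<close>, continued with
  slope \<open>1\<close> to \<open>x \<le> 0\<close>; it is concave. A greedy step from \<open>x\<close> down to \<open>y\<close> costs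
  at most \<open>(x - y) min {1, \<tau>\<^sup>*/x}\<close>, which is at most \<open>\<Phi>(x) - \<Phi>(y)\<close> because \<open>\<Phi>\<close> lies
  below its tangent at \<open>x\<close>; so \<open>\<tau>(A) + \<Phi>(x)\<close> never increases.
  If \<open>x > \<tau>\<^sup>*\<close>, then \<open>A\<^sup>*\<close> itself satisfies the density condition, so the algorithm stops only
  when \<open>x \<le> \<tau>\<^sup>*\<close>, where \<open>\<Phi>(x) = x\<close>. The initial value of \<open>\<Phi>\<close> is
  \<open>\<tau>\<^sup>* + \<tau>\<^sup>* ln ((\<nu>\<^sub>0 - \<nu>\<^sup>*)/\<tau>\<^sup>*)\<close>, since optimality against the empty set gives \<open>\<nu>\<^sub>0 - \<nu>\<^sup>* \<ge> \<tau>\<^sup>*\<close>.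
\<close>

text \<open>
  \<open>\<Phi>(x)\<close> for \<open>s = \<tau>\<^sup>*\<close>. If \<open>s = 0\<close>, the division by zero is harmless: the value at \<open>x > 0\<close> is
  \<open>0\<close>, as it should be.
\<close>

definition greedy_potential :: "real \<Rightarrow> real \<Rightarrow> real" where
  "greedy_potential s x = (if x \<le> s then x else s + s * ln (x / s))"

lemma greedy_potential_eq_self:
  assumes "x \<le> s"
  shows "greedy_potential s x = x"
  using assms by (simp add: greedy_potential_def)

lemma greedy_potential_eq_ln:
  assumes "s \<le> x"
  shows "greedy_potential s x = s + s * ln (x / s)"
  using assms by (auto simp: greedy_potential_def)

text \<open>The right-hand side, as a function of \<open>y\<close>, is the tangent of the potential at \<open>t\<close>.\<close>

lemma greedy_potential_le_line:
  assumes s: "0 \<le> s" "s \<le> t" and t: "0 < t"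
  shows "greedy_potential s y \<le> s * ln (t / s) + s * (y / t)"
proof (cases "s = 0")
  case True
  then show ?thesis by (simp add: greedy_potential_def)
next
  case False
  then have s_pos: "0 < s" using s by simp
  show ?thesis
  proof (cases "y \<le> s")
    case True
    have "y * (1 - s / t) \<le> s * (1 - s / t)"
      using True s t by (intro mult_right_mono) auto
    also have "1 - s / t \<le> ln (t / s)"
      using ln_diff_le[OF s_pos t] s_pos t by (simp add: ln_div diff_divide_distrib)
    finally have "y * (1 - s / t) \<le> s * ln (t / s)"
      using s_pos by (simp add: mult_left_mono)
    then show ?thesis
      using True by (simp add: greedy_potential_eq_self algebra_simps)
  next
    case False
    then have "ln y - ln t \<le> y / t - 1"
      using ln_diff_le[of y t] s_pos t by (simp add: diff_divide_distrib)
    then have "s * (ln y - ln t) \<le> s * (y / t - 1)"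
      using s_pos by (intro mult_left_mono) auto
    then show ?thesis
      using False s_pos t by (simp add: greedy_potential_eq_ln ln_div algebra_simps)
  qed
qed

lemma greedy_potential_le_tangent:
  assumes s: "0 \<le> s" and x: "0 < x"
  shows "greedy_potential s y \<le> greedy_potential s x + min 1 (s / x) * (y - x)"
proof (cases "x \<le> s")
  case True
  then have "greedy_potential s y \<le> y"
    using greedy_potential_le_line[of s s y] x by simp
  then show ?thesis
    using True x by (simp add: greedy_potential_eq_self)
next
  case False
  then have "min 1 (s / x) = s / x" using x by simp
  then show ?thesis
    using greedy_potential_le_line[OF s _ x, of y] False x
    by (simp add: greedy_potential_eq_ln right_diff_distrib)
qed

lemma greedy_step_subset:
  assumes "greedy_step U \<nu> \<tau> \<nu>s \<tau>s A A'" "A \<subseteq> U"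
  shows "A' \<subseteq> U"
  using assms by (auto simp: greedy_step_def)

lemma greedy_step_psubset:
  assumes "greedy_step U \<nu> \<tau> \<nu>s \<tau>s A A'"
  shows "A \<subset> A'"
  using assms by (auto simp: greedy_step_def density_condition_def)

lemma greedy_run_subset:
  assumes "(greedy_step U \<nu> \<tau> \<nu>s \<tau>s)\<^sup>*\<^sup>* A A'" "A \<subseteq> U"
  shows "A' \<subseteq> U"
  using assms by (induction rule: rtranclp_induct) (auto dest: greedy_step_subset)

lemma no_greedy_infinite_run:
  assumes "finite U"
  shows "\<not> greedy_infinite_run U \<nu> \<tau> \<nu>s \<tau>s f"
proof
  assume "greedy_infinite_run U \<nu> \<tau> \<nu>s \<tau>s f"
  then have start: "f 0 = {}" and step: "\<And>i. greedy_step U \<nu> \<tau> \<nu>s \<tau>s (f i) (f (Suc i))"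
    by (auto simp: greedy_infinite_run_def)
  have "strict_mono f"
    using greedy_step_psubset[OF step] by (simp add: strict_mono_Suc_iff)
  then have "infinite (range f)"
    by (simp add: finite_image_iff strict_mono_imp_inj_on)
  moreover have "f i \<subseteq> U" for i
    by (induction i) (simp_all add: start greedy_step_subset[OF step])
  then have "range f \<subseteq> Pow U" by blast
  ultimately show False
    using assms finite_subset by blast
qed

lemma greedy_step_potential_le:
  assumes step: "greedy_step U \<nu> \<tau> \<nu>s \<tau>s A A'" and A: "A \<subseteq> U"
    and subadditive: "set_subadditive_on U \<tau>" and \<tau>s_nonneg: "0 \<le> \<tau>s"
  shows "\<tau> A' + greedy_potential \<tau>s (\<nu> A' - \<nu>s) \<le> \<tau> A + greedy_potential \<tau>s (\<nu> A - \<nu>s)"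
proof -
  let ?slope = "min 1 (\<tau>s / (\<nu> A - \<nu>s))"
  obtain B where B: "B \<subseteq> U" "A' = A \<union> B" and above: "\<nu>s < \<nu> A" and less: "\<nu> A' < \<nu> A"
    and density: "\<tau> B / (\<nu> A - \<nu> A') \<le> ?slope"
    using step unfolding greedy_step_def density_condition_def by blast
  have "\<tau> A' \<le> \<tau> A + \<tau> B"
    using subadditive A B by (simp add: set_subadditive_on_def)
  moreover have "\<tau> B \<le> ?slope * (\<nu> A - \<nu> A')"
    using density less by (simp only: pos_divide_le_eq diff_gt_0_iff_gt)
  moreover have "greedy_potential \<tau>s (\<nu> A' - \<nu>s)
      \<le> greedy_potential \<tau>s (\<nu> A - \<nu>s) - ?slope * (\<nu> A - \<nu> A')"
    using greedy_potential_le_tangent[OF \<tau>s_nonneg, of "\<nu> A - \<nu>s" "\<nu> A' - \<nu>s"] above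
    by (simp add: right_diff_distrib)
  ultimately show ?thesis by linarith
qed

lemma greedy_run_potential_le:
  assumes run: "(greedy_step U \<nu> \<tau> \<nu>s \<tau>s)\<^sup>*\<^sup>* A A'" and A: "A \<subseteq> U"
    and subadditive: "set_subadditive_on U \<tau>" and \<tau>s_nonneg: "0 \<le> \<tau>s"
  shows "\<tau> A' + greedy_potential \<tau>s (\<nu> A' - \<nu>s) \<le> \<tau> A + greedy_potential \<tau>s (\<nu> A - \<nu>s)"
  using run
proof (induction rule: rtranclp_induct)
  case base
  show ?case by simp
next
  case (step B C)
  have "B \<subseteq> U" using greedy_run_subset[OF step.hyps(1) A] .
  from greedy_step_potential_le[OF step.hyps(2) this subadditive \<tau>s_nonneg] step.IH
  show ?case by (rule order_trans)
qed

lemma greedy_step_Un: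
  assumes A: "A \<subseteq> U" and S: "S \<subseteq> U" "\<nu> S \<le> \<nu>s" "0 \<le> \<tau> S" "\<tau> S \<le> \<tau>s"
    and decreasing: "antimono_on (Pow U) \<nu>" and large: "\<tau>s < \<nu> A - \<nu>s"
  shows "greedy_step U \<nu> \<tau> \<nu>s \<tau>s A (A \<union> S)"
proof -
  have "\<nu> (A \<union> S) \<le> \<nu> S"
    using A S(1) by (intro monotone_onD[OF decreasing]) auto
  with S have target: "\<nu> (A \<union> S) \<le> \<nu>s" by simp
  have above: "\<nu>s < \<nu> A" using S large by linarith
  have "\<tau> S / (\<nu> A - \<nu> (A \<union> S)) \<le> \<tau>s / (\<nu> A - \<nu>s)"
    using S target above by (intro frac_le) auto
  moreover have "\<tau>s / (\<nu> A - \<nu>s) \<le> 1"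
    using large above by simp
  ultimately have "density_condition \<nu> \<tau> \<nu>s \<tau>s A S"
    using target above by (simp add: density_condition_def)
  moreover have "S \<noteq> {}" using target above by auto
  ultimately show ?thesis
    using S(1) above by (auto simp: greedy_step_def)
qed

lemma greedy_output_subset:
  assumes "greedy_output U \<nu> \<tau> \<nu>s \<tau>s A"
  shows "A \<subseteq> U"
  using assms greedy_run_subset by (fastforce simp: greedy_output_def)

lemma greedy_output_cost_le:
  assumes stopped: "greedy_output U \<nu> \<tau> \<nu>s \<tau>s A"
    and S: "S \<subseteq> U" "\<nu> S \<le> \<nu>s" "0 \<le> \<tau> S" "\<tau> S \<le> \<tau>s"
    and decreasing: "antimono_on (Pow U) \<nu>" and subadditive: "set_subadditive_on U \<tau>"
  shows "\<nu> A + \<tau> A \<le> \<nu>s + \<tau> {} + greedy_potential \<tau>s (\<nu> {} - \<nu>s)"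
proof -
  have "\<nu> A - \<nu>s \<le> \<tau>s"
  proof (rule ccontr)
    assume "\<not> \<nu> A - \<nu>s \<le> \<tau>s"
    then have "greedy_step U \<nu> \<tau> \<nu>s \<tau>s A (A \<union> S)"
      using greedy_output_subset[OF stopped] S decreasing by (intro greedy_step_Un) auto
    then show False using stopped by (auto simp: greedy_output_def)
  qed
  moreover have "\<tau> A + greedy_potential \<tau>s (\<nu> A - \<nu>s) \<le> \<tau> {} + greedy_potential \<tau>s (\<nu> {} - \<nu>s)"
    using stopped S subadditive by (intro greedy_run_potential_le) (auto simp: greedy_output_def)
  ultimately show ?thesis by (simp add: greedy_potential_eq_self)
qed

theorem theorem4:
  fixes U :: "'a set" and \<nu> \<tau> :: "'a set \<Rightarrow> real" and Astar :: "'a set"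
    and nu_star tau_star opt nu0 :: real
  assumes nu_nonneg: "\<And>A. A \<subseteq> U \<Longrightarrow> \<nu> A \<ge> 0"
    and tau_nonneg: "\<And>A. A \<subseteq> U \<Longrightarrow> \<tau> A \<ge> 0"
    and nu_decreasing: "antimono_on (Pow U) \<nu>"
    and tau_subadditive: "set_subadditive_on U \<tau>"
    and tau_empty: "\<tau> {} = 0"
    and Astar_optimal: "optimal_solution U \<nu> \<tau> Astar"
    and nu_star: "nu_star = \<nu> Astar"
    and tau_star: "tau_star = \<tau> Astar"
    and opt: "opt = tau_star + nu_star"
    and nu0: "nu0 = \<nu> {}"
  shows "(finite U \<longrightarrow> (\<nexists>f. greedy_infinite_run U \<nu> \<tau> nu_star tau_star f)) \<and>
    (\<forall>A. greedy_output U \<nu> \<tau> nu_star tau_star A \<longrightarrow>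
       A \<subseteq> U \<and>
       \<nu> A + \<tau> A \<le> (1 + tau_star / opt * ln ((nu0 - nu_star) / tau_star)) * opt) \<and>
    1 + tau_star / opt * ln ((nu0 - nu_star) / tau_star) =
    1 + tau_star / opt * ln (1 + (nu0 - opt) / tau_star)"
proof (intro conjI impI allI)
  show "\<nexists>f. greedy_infinite_run U \<nu> \<tau> nu_star tau_star f" if "finite U"
    using no_greedy_infinite_run[OF that] by blast
next
  fix A
  assume stopped: "greedy_output U \<nu> \<tau> nu_star tau_star A"
  then show "A \<subseteq> U" by (rule greedy_output_subset)
  have Astar: "Astar \<subseteq> U" and opt_le: "\<nu> Astar + \<tau> Astar \<le> \<nu> {} + \<tau> {}"
    using Astar_optimal by (auto simp: optimal_solution_def)
  have "\<nu> A + \<tau> A \<le> nu_star + greedy_potential tau_star (nu0 - nu_star)"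
    using greedy_output_cost_le[OF stopped Astar _ _ _ nu_decreasing tau_subadditive]
      tau_nonneg[OF Astar] by (simp add: nu_star tau_star nu0 tau_empty)
  also have "\<dots> = opt + tau_star * ln ((nu0 - nu_star) / tau_star)"
    using opt_le by (simp add: greedy_potential_eq_ln opt nu_star tau_star nu0 tau_empty)
  also have "\<dots> = (1 + tau_star / opt * ln ((nu0 - nu_star) / tau_star)) * opt"
    using nu_nonneg[OF Astar] tau_nonneg[OF Astar]
    by (cases "opt = 0") (auto simp: opt nu_star tau_star distrib_right)
  finally show "\<nu> A + \<tau> A \<le> (1 + tau_star / opt * ln ((nu0 - nu_star) / tau_star)) * opt" .
next
  show "1 + tau_star / opt * ln ((nu0 - nu_star) / tau_star) =
    1 + tau_star / opt * ln (1 + (nu0 - opt) / tau_star)"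
    by (cases "tau_star = 0") (simp_all add: opt diff_divide_distrib add_divide_distrib)
qed

end
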